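(* Let $X$ be a real normed space of dimension at least $2$ (not necessarily finite-dimensional) with a norm which has a smooth point on its unit sphere. Then $m(X\oplus_1\mathbb{R})=4$.
   Context: A smooth point on the unit sphere of $X$ is a point of the unit sphere at which the norm is G\^ateaux differentiable, or equivalently, a point on the unit sphere at which the unit ball has only one supporting hyperplane. $X\oplus_1\mathbb{R}$ is the direct sum $X\oplus\mathbb{R}$ with norm $\|(x,r)\|=\|x\|_X+|r|$. A subset $A$ of a normed space $Y$ is $\lambda$-equilateral if $\|x-y\|=\lambda$ for all distinct $x,y\in A$; $A$ is equilateral if it is $\lambda$-equilateral for some $\lambda>0$. An equilateral set $A\subseteq Y$ is maximal if there is no equilateral set $A'\subseteq Y$ with $A\subsetneq A'$. $m(Y)$ denotes the minimum cardinality of a maximal equilateral set in $Y$. *)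

theory Defs
  imports "HOL-Analysis.Analysis" "HOL-Library.Extended_Nat"
begin

section \<open>The direct sum of two normed spaces with the sum norm\<close>

text \<open>The product type \<open>'a \<times> 'b\<close> already carries the Euclidean combination of the two norms,
  so the sum norm needs a type of its own.\<close>

datatype ('a, 'b) l1_sum = L1_Pair (l1_fst: 'a) (l1_snd: 'b)

instantiation l1_sum :: (real_vector, real_vector) real_vector
begin

definition zero_l1_sum :: "('a, 'b) l1_sum" where
  "0 = L1_Pair 0 0"

definition plus_l1_sum :: "('a, 'b) l1_sum \<Rightarrow> ('a, 'b) l1_sum \<Rightarrow> ('a, 'b) l1_sum" where
  "p + q = L1_Pair (l1_fst p + l1_fst q) (l1_snd p + l1_snd q)"

definition minus_l1_sum :: "('a, 'b) l1_sum \<Rightarrow> ('a, 'b) l1_sum \<Rightarrow> ('a, 'b) l1_sum" where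
  "p - q = L1_Pair (l1_fst p - l1_fst q) (l1_snd p - l1_snd q)"

definition uminus_l1_sum :: "('a, 'b) l1_sum \<Rightarrow> ('a, 'b) l1_sum" where
  "- p = L1_Pair (- l1_fst p) (- l1_snd p)"

definition scaleR_l1_sum :: "real \<Rightarrow> ('a, 'b) l1_sum \<Rightarrow> ('a, 'b) l1_sum" where
  "c *\<^sub>R p = L1_Pair (c *\<^sub>R l1_fst p) (c *\<^sub>R l1_snd p)"

instance
  by standard
    (simp_all add: zero_l1_sum_def plus_l1_sum_def minus_l1_sum_def uminus_l1_sum_def
      scaleR_l1_sum_def algebra_simps)

end

instantiation l1_sum :: (real_normed_vector, real_normed_vector) real_normed_vector
begin

definition norm_l1_sum :: "('a, 'b) l1_sum \<Rightarrow> real" where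
  "norm_l1_sum p = norm (l1_fst p) + norm (l1_snd p)"

definition dist_l1_sum :: "('a, 'b) l1_sum \<Rightarrow> ('a, 'b) l1_sum \<Rightarrow> real" where
  "dist_l1_sum p q = norm (p - q)"

definition sgn_l1_sum :: "('a, 'b) l1_sum \<Rightarrow> ('a, 'b) l1_sum" where
  "sgn_l1_sum p = p /\<^sub>R norm p"

definition uniformity_l1_sum :: "(('a, 'b) l1_sum \<times> ('a, 'b) l1_sum) filter" where
  "uniformity_l1_sum = (INF e\<in>{0<..}. principal {(p, q). dist p q < e})"

definition open_l1_sum :: "('a, 'b) l1_sum set \<Rightarrow> bool" where
  "open_l1_sum U \<longleftrightarrow> (\<forall>p\<in>U. eventually (\<lambda>(p', q). p' = p \<longrightarrow> q \<in> U) uniformity)"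

instance
proof
  fix p q :: "('a, 'b) l1_sum" and c :: real and U :: "('a, 'b) l1_sum set"
  show "dist p q = norm (p - q)"
    by (rule dist_l1_sum_def)
  show "sgn p = p /\<^sub>R norm p"
    by (rule sgn_l1_sum_def)
  show "uniformity = (INF e\<in>{0<..}. principal {(p, q :: ('a, 'b) l1_sum). dist p q < e})"
    by (rule uniformity_l1_sum_def)
  show "open U \<longleftrightarrow> (\<forall>p\<in>U. eventually (\<lambda>(p', q). p' = p \<longrightarrow> q \<in> U) uniformity)"
    by (rule open_l1_sum_def)
  show "norm p = 0 \<longleftrightarrow> p = 0"
    by (simp add: norm_l1_sum_def zero_l1_sum_def l1_sum.expand add_nonneg_eq_0_iff)
      (metis l1_sum.collapse l1_sum.sel)
  show "norm (p + q) \<le> norm p + norm q"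
    using norm_triangle_ineq[of "l1_fst p" "l1_fst q"] norm_triangle_ineq[of "l1_snd p" "l1_snd q"]
    by (simp add: norm_l1_sum_def plus_l1_sum_def)
  show "norm (c *\<^sub>R p) = \<bar>c\<bar> * norm p"
    by (simp add: norm_l1_sum_def scaleR_l1_sum_def distrib_left)
qed

end


section \<open>Smooth points\<close>

definition has_gateaux_derivative ::
  "('a::real_normed_vector \<Rightarrow> 'b::real_normed_vector) \<Rightarrow> ('a \<Rightarrow> 'b) \<Rightarrow> 'a \<Rightarrow> bool" where
  "has_gateaux_derivative f D x \<longleftrightarrow>
     bounded_linear D \<and> (\<forall>h. ((\<lambda>t. f (x + t *\<^sub>R h)) has_vector_derivative D h) (at 0))"

definition smooth_point :: "'a::real_normed_vector \<Rightarrow> bool" where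
  "smooth_point x \<longleftrightarrow> x \<in> sphere 0 1 \<and> (\<exists>D. has_gateaux_derivative norm D x)"


section \<open>Equilateral sets\<close>

definition equilateral_with :: "real \<Rightarrow> 'a::real_normed_vector set \<Rightarrow> bool" where
  "equilateral_with l A \<longleftrightarrow> (\<forall>x\<in>A. \<forall>y\<in>A. x \<noteq> y \<longrightarrow> norm (x - y) = l)"

definition equilateral :: "'a::real_normed_vector set \<Rightarrow> bool" where
  "equilateral A \<longleftrightarrow> (\<exists>l>0. equilateral_with l A)"

definition maximal_equilateral :: "'a::real_normed_vector set \<Rightarrow> bool" where
  "maximal_equilateral A \<longleftrightarrow> equilateral A \<and> (\<nexists>A'. equilateral A' \<and> A \<subset> A')"

text \<open>All infinite cardinalities are identified with \<open>\<infinity>\<close>, because \<open>card\<close> is \<open>0\<close> on infinite sets.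
  As \<open>enat\<close> is well-ordered, the infimum below is a minimum whenever maximal equilateral sets
  exist.\<close>

definition min_card_maximal_equilateral :: "'a::real_normed_vector itself \<Rightarrow> enat" where
  "min_card_maximal_equilateral _ =
     (INF A\<in>{A :: 'a set. maximal_equilateral A}. if finite A then enat (card A) else \<infinity>)"

end

theory Submission
  imports Defs
begin

text \<open>
  The minimum is attained by the four points \<open>(0, \<plusminus>1)\<close> and \<open>(\<plusminus>x, 0)\<close>, where \<open>x\<close> is a smooth
  point. They are 2-equilateral, and a fifth point at distance 2 from all of them would have the
  form \<open>(y, 0)\<close> with \<open>\<parallel>y\<parallel> = 1\<close> and \<open>\<parallel>x - y\<parallel> = \<parallel>x + y\<parallel> = 2\<close>. By the triangle inequality the norm then
  grows at unit speed from \<open>x\<close> in both of the directions \<open>y\<close> and \<open>- y\<close>, so that the derivative of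
  the norm at \<open>x\<close> cannot be linear (\<open>no_unit_vector_opposite_to_both\<close>).

  No smaller maximal equilateral set exists, because \<open>X \<oplus>\<^sub>1 \<real>\<close> has dimension at least 3 and in such
  a space every equilateral set of at most three points can be extended
  (\<open>maximal_equilateral_card_ge_4\<close>); this is a theorem of Petty. The case of three points, which
  may be taken to be \<open>0\<close>, \<open>p\<close>, \<open>q\<close> with mutual distances 1, is the substantial one
  (\<open>fourth_equidistant_point\<close>). The point \<open>p - q\<close> is, like \<open>q\<close>, at distance 1 from both \<open>0\<close> and
  \<open>p\<close>, and its distance from \<open>q\<close> is at least 1 since \<open>\<parallel>2 q - p\<parallel> \<ge> 2 \<parallel>q\<parallel> - \<parallel>p\<parallel>\<close>. By the intermediate
  value theorem it suffices to join \<open>q\<close> to \<open>p - q\<close> inside a connected set of points at distance 1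
  from both \<open>0\<close> and \<open>p\<close>. Rotate a half-plane about the line through \<open>p\<close>, from the side containing
  \<open>q\<close> to the opposite side; it meets the unit sphere in an arc from \<open>p\<close> to \<open>- p\<close>. Along each arc the
  distance from \<open>p\<close> increases weakly from 0 to 2 (\<open>arc_distance_mono\<close>), so the points of the arc
  at distance 1 from \<open>p\<close> form a nonempty interval of parameters. The norm need not be strictly
  convex, so that this interval may be nondegenerate and no continuous choice of a point is at hand;
  but a compact set that maps onto a connected space with connected fibres is itself connected.
\<close>

section \<open>The monotonicity lemma for arcs of the unit circle\<close>

text \<open>
  The segments from \<open>0\<close> to \<open>q\<close> and from \<open>p\<close> to \<open>r\<close> cross at a point \<open>x\<close>. As \<open>q\<close> and \<open>r\<close> have the same
  norm, \<open>q\<close> is no further from \<open>x\<close> than \<open>r\<close> is, and the detour from \<open>q\<close> to \<open>p\<close> through \<open>x\<close> is therefore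
  no longer than the straight path from \<open>r\<close> to \<open>p\<close>.
\<close>

lemma monotonicity_lemma:
  fixes p q r :: "'a::real_normed_vector"
  assumes unit: "norm p = 1" "norm q = 1" "norm r = 1"
    and q: "q = \<alpha> *\<^sub>R p + \<beta> *\<^sub>R r" and nonneg: "\<alpha> \<ge> 0" "\<beta> \<ge> 0"
  shows "norm (q - p) \<le> norm (r - p)"
proof -
  define s where "s = \<alpha> + \<beta>"
  have "norm q \<le> norm (\<alpha> *\<^sub>R p) + norm (\<beta> *\<^sub>R r)"
    unfolding q by (rule norm_triangle_ineq)
  then have s1: "s \<ge> 1"
    using unit nonneg by (simp add: s_def)
  \<comment> \<open>Since \<open>s \<ge> 1\<close>, the crossing point lies between \<open>0\<close> and \<open>q\<close>, not beyond \<open>q\<close>.\<close>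
  define x where "x = q /\<^sub>R s"
  have q_x: "q = s *\<^sub>R x"
    using s1 by (simp add: x_def)
  have norm_x: "norm x = 1 / s"
    using s1 unit by (simp add: x_def divide_inverse)
  have x: "x = (\<alpha> / s) *\<^sub>R p + (\<beta> / s) *\<^sub>R r"
    by (simp add: x_def q algebra_simps divide_inverse)
  have sum1: "\<alpha> / s + \<beta> / s = 1"
    using s1 by (simp add: s_def flip: add_divide_distrib)
  have xp: "x - p = (\<beta> / s) *\<^sub>R (r - p)"
  proof -
    have "x - p = (\<alpha> / s) *\<^sub>R p + (\<beta> / s) *\<^sub>R r - (\<alpha> / s + \<beta> / s) *\<^sub>R p"
      by (simp add: x sum1)
    then show ?thesis by (simp add: algebra_simps)
  qed
  have rx: "r - x = (\<alpha> / s) *\<^sub>R (r - p)"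
  proof -
    have "r - x = (\<alpha> / s + \<beta> / s) *\<^sub>R r - ((\<alpha> / s) *\<^sub>R p + (\<beta> / s) *\<^sub>R r)"
      by (simp add: x sum1)
    then show ?thesis by (simp add: algebra_simps)
  qed
  have "q - x = (s - 1) *\<^sub>R x"
    by (simp add: q_x algebra_simps)
  then have "norm (q - x) = (s - 1) * (1 / s)"
    using s1 by (simp add: norm_x)
  then have "norm (q - x) = 1 - norm x"
    using s1 by (simp add: norm_x field_simps)
  also have "\<dots> \<le> norm (r - x)"
    using norm_triangle_sub[of r x] unit by simp
  finally have "norm (q - p) \<le> norm (r - x) + norm (x - p)"
    using norm_triangle_ineq[of "q - x" "x - p"] by simp
  also have "\<dots> = (\<alpha> / s + \<beta> / s) * norm (r - p)"
    using nonneg s1 by (simp add: rx xp distrib_right)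
  finally show ?thesis
    by (simp add: sum1)
qed

text \<open>
  For \<open>\<phi>\<close> from \<open>0\<close> to \<open>pi\<close> this runs along the unit circle of the plane spanned by \<open>p\<close> and \<open>w\<close>, from \<open>p\<close>
  to \<open>- p\<close> on the side of \<open>w\<close>. Only the order of the directions matters, so \<open>\<phi>\<close> need not be an
  angle for the norm in question.
\<close>

definition unit_arc :: "'a::real_normed_vector \<Rightarrow> 'a \<Rightarrow> real \<Rightarrow> 'a" where
  "unit_arc p w \<phi> = sgn (cos \<phi> *\<^sub>R p + sin \<phi> *\<^sub>R w)"

lemma arc_direction_nonzero:
  fixes p w :: "'a::real_normed_vector"
  assumes "p \<noteq> 0" "w \<notin> span {p}"
  shows "cos \<phi> *\<^sub>R p + sin \<phi> *\<^sub>R w \<noteq> 0"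
proof
  assume eq: "cos \<phi> *\<^sub>R p + sin \<phi> *\<^sub>R w = 0"
  show False
  proof (cases "sin \<phi> = 0")
    case True
    then have "cos \<phi> \<noteq> 0"
      using sin_cos_squared_add[of \<phi>] by auto
    then show False using eq True assms by simp
  next
    case False
    have "sin \<phi> *\<^sub>R w = (- cos \<phi>) *\<^sub>R p"
      using eq by (simp add: add_eq_0_iff)
    then have "sin \<phi> *\<^sub>R w \<in> span {p}"
      by (simp add: span_base span_scale span_neg)
    then have "(1 / sin \<phi>) *\<^sub>R sin \<phi> *\<^sub>R w \<in> span {p}"
      by (rule span_scale)
    then show False using False assms by simp
  qed
qed

lemma norm_arc:
  assumes "p \<noteq> 0" "w \<notin> span {p}"
  shows "norm (unit_arc p w \<phi>) = 1"
  using arc_direction_nonzero[OF assms] by (simp add: unit_arc_def norm_sgn)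

lemma arc_pi:
  assumes "norm p = 1"
  shows "unit_arc p w pi = - p"
  using assms by (simp add: unit_arc_def sgn_minus) (simp add: sgn_div_norm)

text \<open>
  For \<open>\<phi> < \<psi> < pi\<close> the direction of the arc at \<open>\<phi>\<close> lies in the cone spanned by \<open>p\<close> and the direction
  at \<open>\<psi>\<close>, by the addition theorem for the sine, which is the situation of the monotonicity lemma.
  At \<open>\<psi> = pi\<close> this cone degenerates, but there the distance has its largest possible value 2.
\<close>

lemma arc_distance_mono:
  fixes p w :: "'a::real_normed_vector"
  assumes p: "norm p = 1" and w: "w \<notin> span {p}"
    and range: "0 \<le> \<phi>" "\<phi> \<le> \<psi>" "\<psi> \<le> pi"
  shows "norm (unit_arc p w \<phi> - p) \<le> norm (unit_arc p w \<psi> - p)"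
proof -
  have p0: "p \<noteq> 0" using p by auto
  consider "\<psi> = pi" | "\<phi> = \<psi>" | "\<phi> < \<psi>" "\<psi> < pi" using range by linarith
  then show ?thesis
  proof cases
    case 1
    have "norm (unit_arc p w \<phi> - p) \<le> 2"
      using norm_triangle_ineq4[of "unit_arc p w \<phi>" p] norm_arc[OF p0 w] p by simp
    also have "2 = norm (unit_arc p w \<psi> - p)"
    proof -
      have "unit_arc p w \<psi> - p = (-2) *\<^sub>R p"
        unfolding 1 arc_pi[OF p] by (simp add: scaleR_2)
      then show ?thesis using p by simp
    qed
    finally show ?thesis .
  next
    case 2
    then show ?thesis by simp
  next
    case 3
    define v where "v = (\<lambda>\<phi>. cos \<phi> *\<^sub>R p + sin \<phi> *\<^sub>R w)"
    have v0: "norm (v \<phi>) > 0" for \<phi>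
      using arc_direction_nonzero[OF p0 w] by (simp add: v_def)
    have arc_v: "unit_arc p w \<phi> = v \<phi> /\<^sub>R norm (v \<phi>)" for \<phi>
      by (simp add: unit_arc_def v_def sgn_div_norm)
    have sin_pos: "sin \<psi> > 0"
      using 3 range by (intro sin_gt_zero) auto
    have "v \<phi> = (sin (\<psi> - \<phi>) / sin \<psi>) *\<^sub>R p + (sin \<phi> / sin \<psi>) *\<^sub>R v \<psi>"
      using sin_pos by (simp add: v_def sin_diff algebra_simps diff_divide_distrib add_divide_distrib
          flip: scaleR_add_left)
    then have comb: "unit_arc p w \<phi> = (sin (\<psi> - \<phi>) / sin \<psi> / norm (v \<phi>)) *\<^sub>R p
        + (sin \<phi> / sin \<psi> * norm (v \<psi>) / norm (v \<phi>)) *\<^sub>R unit_arc p w \<psi>"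
      using v0[of \<psi>] by (simp add: arc_v divide_inverse algebra_simps)
    have nonneg: "sin (\<psi> - \<phi>) / sin \<psi> / norm (v \<phi>) \<ge> 0"
      "sin \<phi> / sin \<psi> * norm (v \<psi>) / norm (v \<phi>) \<ge> 0"
      using 3 range sin_pos by (auto intro!: divide_nonneg_nonneg mult_nonneg_nonneg sin_ge_zero)
    show ?thesis
      using monotonicity_lemma[OF p norm_arc[OF p0 w] norm_arc[OF p0 w] comb nonneg] .
  qed
qed

lemma arc_continuous:
  fixes p :: "'a::real_normed_vector" and w :: "'b::t2_space \<Rightarrow> 'a"
  assumes "p \<noteq> 0" "\<And>x. x \<in> S \<Longrightarrow> w x \<notin> span {p}"
    and "continuous_on S \<phi>" "continuous_on S w"
  shows "continuous_on S (\<lambda>x. unit_arc p (w x) (\<phi> x))"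
  unfolding unit_arc_def using assms arc_direction_nonzero[of p]
  by (intro continuous_intros) auto

section \<open>Extending equilateral sets with at most three points\<close>

text \<open>
  The distance from \<open>p\<close> is 0 at the start of the arc and 2 at its end. This extends an
  equilateral pair; for triples the arcs will be varied.
\<close>

lemma arc_third_point:
  fixes p w :: "'a::real_normed_vector"
  assumes p: "norm p = 1" and w: "w \<notin> span {p}"
  obtains \<phi> where "0 \<le> \<phi>" "\<phi> \<le> pi" "norm (unit_arc p w \<phi> - p) = 1"
proof -
  have p0: "p \<noteq> 0" using p by auto
  have "norm (unit_arc p w 0 - p) \<le> 1"
    using p by (simp add: unit_arc_def sgn_div_norm)
  moreover have "1 \<le> norm (unit_arc p w pi - p)"
  proof -
    have "unit_arc p w pi - p = (-2) *\<^sub>R p"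
      unfolding arc_pi[OF p] by (simp add: scaleR_2)
    then show ?thesis using p by simp
  qed
  moreover have "continuous_on {0..pi} (\<lambda>\<phi>. norm (unit_arc p w \<phi> - p))"
    using p0 w by (intro continuous_intros arc_continuous) auto
  ultimately show ?thesis
    using IVT'[of "\<lambda>\<phi>. norm (unit_arc p w \<phi> - p)" 0 1 pi] that by force
qed

text \<open>
  The vector \<open>d\<close> serves to rotate \<open>q\<close> into \<open>- q\<close> without meeting the line through \<open>p\<close>. The connected
  set is built not in the space itself but in the parameter square \<open>{0..pi} \<times> {0..pi}\<close>, because there
  compactness and continuity of the projection to the rotation angle come for free.
\<close>

lemma fourth_equidistant_point:
  fixes p q d :: "'a::real_normed_vector"
  assumes unit: "norm p = 1" "norm q = 1" "norm (q - p) = 1"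
    and d: "d \<notin> span {p, q}"
  shows "\<exists>z. norm z = 1 \<and> norm (z - p) = 1 \<and> norm (z - q) = 1"
proof -
  have p0: "p \<noteq> 0" using unit by auto
  have q_notin: "q \<notin> span {p}"
  proof
    assume "q \<in> span {p}"
    then obtain k where k: "q = k *\<^sub>R p" by (auto simp: span_singleton)
    then have "q - p = (k - 1) *\<^sub>R p" by (simp add: algebra_simps)
    then show False using unit k by (auto simp: abs_if split: if_splits)
  qed
  \<comment> \<open>The half-plane at \<open>\<theta>\<close> is bounded by the line through \<open>p\<close> and contains \<open>w \<theta>\<close>.\<close>
  define w where "w = (\<lambda>\<theta>. cos \<theta> *\<^sub>R q + sin \<theta> *\<^sub>R d)"
  have w: "w \<theta> \<notin> span {p}" for \<theta>
  proof
    assume in_span: "w \<theta> \<in> span {p}"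
    show False
    proof (cases "sin \<theta> = 0")
      case True
      then have "cos \<theta> \<noteq> 0"
        using sin_cos_squared_add[of \<theta>] by auto
      then show False
        using span_scale[OF in_span, of "1 / cos \<theta>"] True q_notin by (simp add: w_def)
    next
      case False
      have "w \<theta> \<in> span {p, q}" "q \<in> span {p, q}"
        using in_span span_mono[of "{p}" "{p, q}"] by (auto intro: span_base)
      then have "(1 / sin \<theta>) *\<^sub>R (w \<theta> - cos \<theta> *\<^sub>R q) \<in> span {p, q}"
        by (intro span_scale span_diff)
      then show False using False d by (simp add: w_def)
    qed
  qed
  define U where "U = (\<lambda>(\<phi>, \<theta>). unit_arc p (w \<theta>) \<phi>)"
  have cont_U: "continuous_on T U" for T
    unfolding U_def case_prod_beta w_def
    by (intro arc_continuous continuous_intros) (use p0 w in \<open>auto simp: w_def\<close>)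
  have norm_U: "norm (U x) = 1" for x
    using norm_arc[OF p0 w] by (simp add: U_def case_prod_beta)
  define S where "S = ({0..pi} \<times> {0..pi}) \<inter> {x. norm (U x - p) = 1}"
  have "closed {x. norm (U x - p) = 1}"
    by (intro closed_Collect_eq continuous_intros cont_U)
  then have "compact S"
    unfolding S_def by (intro compact_Int_closed compact_Times) auto
  have S_proj: "snd ` S = {0..pi}"
  proof
    show "{0..pi} \<subseteq> snd ` S"
    proof
      fix \<theta> :: real assume "\<theta> \<in> {0..pi}"
      moreover obtain \<phi> where "0 \<le> \<phi>" "\<phi> \<le> pi" "norm (unit_arc p (w \<theta>) \<phi> - p) = 1"
        using arc_third_point[OF unit(1) w] .
      ultimately have "(\<phi>, \<theta>) \<in> S" by (simp add: S_def U_def)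
      then show "\<theta> \<in> snd ` S" by force
    qed
  qed (auto simp: S_def)
  \<comment> \<open>Monotonicity along the arc turns the level set of the distance into an interval.\<close>
  have fibre: "connected (S \<inter> snd -` {\<theta>})" for \<theta>
  proof -
    define I where "I = {\<phi>. (\<phi>, \<theta>) \<in> S}"
    have "\<phi> \<in> I" if "a \<in> I" "b \<in> I" "a \<le> \<phi>" "\<phi> \<le> b" for a b \<phi>
      using that arc_distance_mono[OF unit(1) w[of \<theta>], of a \<phi>]
        arc_distance_mono[OF unit(1) w[of \<theta>], of \<phi> b]
      by (auto simp: I_def S_def U_def)
    then have "connected I"
      unfolding connected_iff_interval by blast
    then have "connected ((\<lambda>\<phi>. (\<phi>, \<theta>)) ` I)"
      by (intro connected_continuous_image continuous_intros)
    also have "(\<lambda>\<phi>. (\<phi>, \<theta>)) ` I = S \<inter> snd -` {\<theta>}"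
      by (auto simp: I_def)
    finally show ?thesis .
  qed
  have cont_snd: "continuous_on S snd"
    by (intro continuous_intros)
  have "connected (S \<inter> snd -` {0..pi})"
    by (rule connected_closed_monotone_preimage[OF cont_snd S_proj _ fibre])
      (auto intro: Abstract_Topology_2.continuous_imp_closed_map[OF _ cont_snd S_proj \<open>compact S\<close>])
  moreover have "S \<inter> snd -` {0..pi} = S"
    using S_proj by blast
  ultimately have "connected S" by simp
  \<comment> \<open>The vector \<open>p - q\<close> bisects \<open>p\<close> and \<open>w pi = - q\<close>, whence the parameter \<open>pi / 4\<close>.\<close>
  have start: "(pi / 2, 0) \<in> S" "U (pi / 2, 0) = q"
    using unit by (simp_all add: S_def U_def unit_arc_def w_def sgn_div_norm)
  have U_end: "U (pi / 4, pi) = p - q"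
  proof -
    have "U (pi / 4, pi) = sgn ((sqrt 2 / 2) *\<^sub>R (p - q))"
      by (simp add: U_def unit_arc_def w_def cos_45 sin_45 algebra_simps)
    also have "\<dots> = sgn (p - q)"
      by (simp add: sgn_scaleR)
    finally show ?thesis
      using unit by (simp add: sgn_div_norm norm_minus_commute)
  qed
  then have end_S: "(pi / 4, pi) \<in> S"
    using unit pi_gt_zero by (simp add: S_def)
  have "norm (q - (p - q)) \<ge> 1"
  proof -
    have "norm (2 *\<^sub>R q) - norm p \<le> norm (2 *\<^sub>R q - p)"
      by (rule norm_triangle_ineq2)
    moreover have "2 *\<^sub>R q - p = q - (p - q)"
      by (simp add: scaleR_2)
    moreover have "norm (2 *\<^sub>R q) = 2"
      using unit by (simp only: norm_scaleR)
    ultimately show ?thesis using unit by simp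
  qed
  then have far: "norm (U (pi / 4, pi) - q) \<ge> 1"
    unfolding U_end by (simp only: norm_minus_commute)
  have "connected ((\<lambda>x. norm (U x - q)) ` S)"
    using \<open>connected S\<close> by (intro connected_continuous_image continuous_intros cont_U)
  then have "1 \<in> (\<lambda>x. norm (U x - q)) ` S"
    by (rule connectedD_interval[OF _ imageI[OF start(1)] imageI[OF end_S]])
      (use start(2) far in auto)
  then obtain x where "x \<in> S" "norm (U x - q) = 1" by auto
  then show ?thesis
    using norm_U by (auto simp: S_def)
qed

lemma equidistant_point_scaled:
  fixes a :: "'a::real_normed_vector"
  assumes l: "l > 0" and z: "norm (z - (b - a) /\<^sub>R l) = 1"
  shows "norm (a + l *\<^sub>R z - b) = l"
proof -
  have "a + l *\<^sub>R z - b = l *\<^sub>R (z - (b - a) /\<^sub>R l)"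
    using l by (simp add: algebra_simps)
  then show ?thesis using l z by simp
qed

lemma exists_notin_span:
  fixes B T :: "'a::real_vector set"
  assumes "independent B" "finite T" "card T < card B"
  shows "\<exists>d. d \<notin> span T"
proof (rule ccontr)
  assume "\<not> ?thesis"
  then have "B \<subseteq> span T" by blast
  then show False using independent_span_bound[of T B] assms by linarith
qed

text \<open>
  Translating one point to \<open>0\<close> and dividing by the common distance reduces pairs and triples to the
  two preceding constructions.
\<close>

lemma maximal_equilateral_card_ge_4:
  fixes A :: "'a::real_normed_vector set"
  assumes dim: "\<exists>B :: 'a set. independent B \<and> card B = 3"
    and max: "maximal_equilateral A" and fin: "finite A"
  shows "card A \<ge> 4"
proof (rule ccontr)
  assume "\<not> card A \<ge> 4"
  then have card: "card A \<le> 3" by simp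
  have outside: "\<exists>d. d \<notin> span T" if "finite T" "card T \<le> 2" for T :: "'a set"
  proof -
    obtain B :: "'a set" where "independent B" "card B = 3" using dim by blast
    then show ?thesis using exists_notin_span[of B T] that by simp
  qed
  obtain l where l: "l > 0" and eq: "equilateral_with l A"
    using max by (auto simp: maximal_equilateral_def equilateral_def)
  \<comment> \<open>A singleton is equilateral for every distance, so the distance \<open>k\<close> to the new point
    cannot be required to be \<open>l\<close>.\<close>
  have "\<exists>k>0. \<exists>z. equilateral_with k A \<and> (\<forall>a\<in>A. norm (z - a) = k)"
  proof -
    consider "card A = 0" | "card A = 1" | "card A = 2" | "card A = 3"
      using card by linarith
    then show ?thesis
    proof cases
      case 1
      then show ?thesis using fin l eq by auto
    next
      case 2
      then obtain a where A: "A = {a}" by (auto simp: card_1_singleton_iff)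
      obtain d :: 'a where "d \<notin> span {}" using outside[of "{}"] by auto
      then have "norm d > 0" by simp
      then show ?thesis
        by (intro exI[of _ "norm d"] conjI exI[of _ "a + d"]) (auto simp: A equilateral_with_def)
    next
      case 3
      then obtain a b where A: "A = {a, b}" "a \<noteq> b" by (auto simp: card_2_iff)
      define p where "p = (b - a) /\<^sub>R l"
      have "norm (b - a) = l" using eq A by (auto simp: equilateral_with_def)
      then have p: "norm p = 1" using l by (simp add: p_def)
      then have p0: "p \<noteq> 0" by auto
      obtain w where w: "w \<notin> span {p}" using outside[of "{p}"] by auto
      obtain \<phi> where "norm (unit_arc p w \<phi> - p) = 1" using arc_third_point[OF p w] by metis
      moreover have "norm (unit_arc p w \<phi> - (a - a) /\<^sub>R l) = 1" using norm_arc[OF p0 w] by simp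
      ultimately have "\<forall>c\<in>A. norm (a + l *\<^sub>R unit_arc p w \<phi> - c) = l"
        using equidistant_point_scaled[OF l] l by (auto simp: A p_def)
      then show ?thesis using l eq by blast
    next
      case 4
      then obtain a b c where A: "A = {a, b, c}" "a \<noteq> b" "a \<noteq> c" "b \<noteq> c"
        by (auto simp: card_3_iff)
      define p q where "p = (b - a) /\<^sub>R l" and "q = (c - a) /\<^sub>R l"
      have "norm (b - a) = l" "norm (c - a) = l" "norm (c - b) = l"
        using eq A by (auto simp: equilateral_with_def)
      moreover have "q - p = (c - b) /\<^sub>R l"
        by (simp add: p_def q_def flip: scaleR_diff_right)
      ultimately have unit: "norm p = 1" "norm q = 1" "norm (q - p) = 1"
        using l by (simp_all add: p_def q_def)
      have "p \<noteq> q" using unit(3) by auto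
      then obtain d where "d \<notin> span {p, q}"
        using outside[of "{p, q}"] by auto
      then obtain z where "norm z = 1" "norm (z - p) = 1" "norm (z - q) = 1"
        using fourth_equidistant_point[OF unit] by blast
      then have "norm (a + l *\<^sub>R z - a) = l" "norm (a + l *\<^sub>R z - b) = l"
        "norm (a + l *\<^sub>R z - c) = l"
        using l equidistant_point_scaled[OF l, of z] by (simp_all add: p_def q_def)
      then have "\<forall>x\<in>A. norm (a + l *\<^sub>R z - x) = l"
        by (simp add: A)
      then show ?thesis using l eq by blast
    qed
  qed
  then obtain k z where k: "k > 0" "equilateral_with k A" and z: "\<forall>a\<in>A. norm (z - a) = k"
    by blast
  have "z \<notin> A" using z k by auto
  moreover have "equilateral (insert z A)"
    using k z unfolding equilateral_def equilateral_with_def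
    by (auto simp: norm_minus_commute)
  ultimately show False
    using max unfolding maximal_equilateral_def by blast
qed

section \<open>A maximal equilateral set with four points\<close>

text \<open>
  If \<open>\<parallel>x + t y\<parallel>\<close> fell short of \<open>1 + t\<close> for some \<open>t\<close> in the unit interval, then the remaining step
  \<open>(1 - t) y\<close> could not bring the norm up to 2. So the norm is affine along this segment.
\<close>

lemma gateaux_derivative_unit_speed:
  fixes x y :: "'a::real_normed_vector"
  assumes unit: "norm x = 1" "norm y = 1" and far: "norm (x + y) = 2"
    and D: "has_gateaux_derivative norm D x"
  shows "D y = 1"
proof -
  have norm_eq: "norm (x + t *\<^sub>R y) = 1 + t" if "t \<in> {0..1}" for t
  proof (rule antisym)
    show "norm (x + t *\<^sub>R y) \<le> 1 + t"
      using norm_triangle_ineq[of x "t *\<^sub>R y"] unit that by simp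
    have "x + y = (x + t *\<^sub>R y) + (1 - t) *\<^sub>R y" by (simp add: algebra_simps)
    then have "2 \<le> norm (x + t *\<^sub>R y) + norm ((1 - t) *\<^sub>R y)"
      using far norm_triangle_ineq by metis
    then show "1 + t \<le> norm (x + t *\<^sub>R y)" using unit that by simp
  qed
  have "((\<lambda>t. norm (x + t *\<^sub>R y)) has_vector_derivative D y) (at 0 within {0..1})"
    using D by (auto simp: has_gateaux_derivative_def intro: has_vector_derivative_at_within)
  moreover have "((\<lambda>t. 1 + t) has_vector_derivative (1::real)) (at 0 within {0..1})"
    by (auto intro!: derivative_eq_intros)
  then have "((\<lambda>t. norm (x + t *\<^sub>R y)) has_vector_derivative 1) (at 0 within {0..1})"
    by (rule has_vector_derivative_transform[rotated 2]) (auto simp: norm_eq)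
  ultimately show ?thesis
    by (intro vector_derivative_unique_within_closed_interval[of 0 1 0]) auto
qed

lemma no_unit_vector_opposite_to_both:
  fixes x y :: "'a::real_normed_vector"
  assumes "smooth_point x" "norm y = 1" "norm (x + y) = 2"
  shows "norm (x - y) \<noteq> 2"
proof
  assume "norm (x - y) = 2"
  obtain D where D: "has_gateaux_derivative norm D x" and x: "norm x = 1"
    using assms by (auto simp: smooth_point_def)
  have "D y = 1" "D (- y) = 1"
    using gateaux_derivative_unit_speed[OF x _ _ D] assms \<open>norm (x - y) = 2\<close> by simp_all
  moreover have "D (- y) = - D y"
    using D by (auto simp: has_gateaux_derivative_def bounded_linear.linear linear_neg)
  ultimately show False by simp
qed

lemma norm_L1_Pair_diff:
  fixes x y :: "'a::real_normed_vector" and r s :: real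
  shows "norm (L1_Pair x r - L1_Pair y s) = norm (x - y) + \<bar>r - s\<bar>"
  by (simp add: norm_l1_sum_def minus_l1_sum_def)

definition cross_set :: "'a::real_normed_vector \<Rightarrow> ('a, real) l1_sum set" where
  "cross_set x = {L1_Pair 0 1, L1_Pair 0 (-1), L1_Pair x 0, L1_Pair (- x) 0}"

text \<open>
  Equal distances from \<open>(0, 1)\<close> and \<open>(0, -1)\<close> force a fifth point into \<open>X \<times> {0}\<close>, and the value 2
  of these distances forces it onto the unit sphere there. Smoothness of \<open>x\<close> then excludes it.
\<close>

lemma maximal_equilateral_cross_set:
  fixes x :: "'a::real_normed_vector"
  assumes smooth: "smooth_point x"
  shows "maximal_equilateral (cross_set x)" "card (cross_set x) = 4"
proof -
  have x: "norm x = 1" using smooth by (simp add: smooth_point_def)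
  then have x0: "x \<noteq> 0" by auto
  have two_x: "norm (x + x) = 2" "norm (- x - x) = 2"
    using x norm_scaleR[of 2 x] norm_scaleR[of "-2" x] by (simp_all add: scaleR_2)
  have neg: "- x \<noteq> x" "x \<noteq> - x"
    using two_x by auto
  show "card (cross_set x) = 4"
    using x0 neg by (simp add: cross_set_def)
  have "equilateral_with 2 (cross_set x)"
    unfolding equilateral_with_def cross_set_def
    using x two_x by (auto simp: norm_L1_Pair_diff)
  moreover have "\<not> equilateral A'" if sub: "cross_set x \<subset> A'" for A'
  proof
    assume "equilateral A'"
    then obtain l where l: "equilateral_with l A'" by (auto simp: equilateral_def)
    obtain z where z: "z \<in> A'" "z \<notin> cross_set x" using sub by blast
    have "L1_Pair 0 1 \<in> A'" "L1_Pair 0 (-1) \<in> A'"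
      using sub by (auto simp: cross_set_def)
    then have "norm (L1_Pair (0::'a) (1::real) - L1_Pair 0 (-1)) = l"
      using l by (auto simp: equilateral_with_def)
    then have "l = 2" by (simp add: norm_L1_Pair_diff)
    obtain y r where yr: "z = L1_Pair y r" by (cases z)
    have dist_z: "norm (z - c) = 2" if "c \<in> cross_set x" for c
    proof -
      have "c \<in> A'" "z \<noteq> c" using sub that z(2) by auto
      then show ?thesis using l z(1) \<open>l = 2\<close> by (simp add: equilateral_with_def)
    qed
    have "norm y + \<bar>r - 1\<bar> = 2" "norm y + \<bar>r + 1\<bar> = 2"
      using dist_z[of "L1_Pair 0 1"] dist_z[of "L1_Pair 0 (-1)"]
      by (simp_all add: cross_set_def yr norm_L1_Pair_diff)
    then have "r = 0" "norm y = 1" by linarith+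
    moreover have "norm (y - x) + \<bar>r\<bar> = 2" "norm (y + x) + \<bar>r\<bar> = 2"
      using dist_z[of "L1_Pair x 0"] dist_z[of "L1_Pair (- x) 0"]
      by (simp_all add: cross_set_def yr norm_L1_Pair_diff)
    ultimately show False
      using no_unit_vector_opposite_to_both[OF smooth, of y]
      by (simp add: norm_minus_commute add.commute)
  qed
  ultimately show "maximal_equilateral (cross_set x)"
    unfolding maximal_equilateral_def by (auto simp: equilateral_def intro!: exI[of _ 2])
qed

lemma independent_3_l1_sum:
  assumes "\<exists>B :: 'x::real_normed_vector set. independent B \<and> card B = 2"
  shows "\<exists>B :: ('x, real) l1_sum set. independent B \<and> card B = 3"
proof -
  define f where "f = (\<lambda>x::'x. L1_Pair x (0::real))"
  define e where "e = L1_Pair (0::'x) (1::real)"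
  obtain B :: "'x set" where B: "independent B" "card B = 2" using assms by blast
  have f: "linear f"
    by (rule linearI) (simp_all add: f_def plus_l1_sum_def scaleR_l1_sum_def)
  have inj: "inj f" by (simp add: inj_def f_def)
  have "independent (f ` B)"
    by (rule linear_independent_injective_image[OF f B(1)]) (rule inj_on_subset[OF inj subset_UNIV])
  moreover have "e \<notin> span (f ` B)"
    using linear_span_image[OF f, of B] by (auto simp: e_def f_def)
  moreover have "card (insert e (f ` B)) = 3"
  proof -
    have "finite B" using B by (auto intro: card_ge_0_finite)
    moreover have "e \<notin> f ` B" by (auto simp: e_def f_def)
    moreover have "card (f ` B) = 2"
      using B inj by (simp add: card_image inj_on_subset)
    ultimately show ?thesis by simp
  qed
  ultimately show ?thesis
    by (intro exI[of _ "insert e (f ` B)"]) (simp add: independent_insert)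
qed

theorem proposition9:
  assumes "\<exists>B :: 'x::real_normed_vector set. independent B \<and> card B = 2"
    and "\<exists>x :: 'x. smooth_point x"
  shows "min_card_maximal_equilateral TYPE(('x, real) l1_sum) = 4"
proof (rule antisym)
  obtain x :: 'x where "smooth_point x" using assms(2) by blast
  note cross = maximal_equilateral_cross_set[OF this]
  have "finite (cross_set x)" by (simp add: cross_set_def)
  then have "min_card_maximal_equilateral TYPE(('x, real) l1_sum) \<le> enat (card (cross_set x))"
    unfolding min_card_maximal_equilateral_def
    using cross by (intro INF_lower2[of "cross_set x"]) auto
  then show "min_card_maximal_equilateral TYPE(('x, real) l1_sum) \<le> 4"
    by (simp add: cross numeral_eq_enat)
  show "4 \<le> min_card_maximal_equilateral TYPE(('x, real) l1_sum)"
    unfolding min_card_maximal_equilateral_def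
    using maximal_equilateral_card_ge_4[OF independent_3_l1_sum[OF assms(1)]]
    by (intro INF_greatest) (auto simp: numeral_eq_enat)
qed

end
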